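(* Let $\langle(p^{(t)},c_t,a_t)\mid t\in\mathbb{N}^0\rangle$ be an LDO-LC problem with $a_t\le 0$ for all $t\in\mathbb{N}^0$. Then the problem satisfies the following free disposability property: for any $T\in\mathbb{N}^0$ and $y\in X$, if $\langle x_t\mid t\ge T\rangle\in\mathcal{F}^T(y)$ and $\langle y_t\mid t\ge T\rangle$ is a sequence satisfying $y_T=x_T=y$ and $x_t\ge y_t\ge 0$ for all $t>T$, then $\langle y_t\mid t\ge T\rangle\in\mathcal{F}^T(y)$.
   Context: $\mathbb{N}$ is the set of strictly positive integers and $\mathbb{N}^0=\mathbb{N}\cup\{0\}$. Fix a real number $b>0$ and let $X=[0,b]\subset\mathbb{R}$. A linear dynamic optimization problem with linear constraints (LDO-LC problem) $\langle(p^{(t)},c_t,a_t)\mid t\in\mathbb{N}^0\rangle$ is given by real sequences with $c_t\ge 0$ and $c_t+a_tb\ge 0$ for all $t\in\mathbb{N}^0$, $\sum_{t=0}^\infty|c_t|<+\infty$, $\sum_{t=0}^\infty|a_t|<+\infty$ and $\sum_{t=0}^\infty|p^{(t)}|<+\infty$. (These imply $c_t+a_tx\ge 0$ for all $x\in X$.) For $t\in\mathbb{N}^0$ and $x\in X$, let $\Omega_t(x)=\{y\in[0,b]\mid y\le c_t+a_tx\}=[0,\min\{c_t+a_tx,b\}]$. For $x\in X$ and $T\in\mathbb{N}^0$, $\mathcal{F}^T(x)$ is the set of trajectories starting at $x$ at time-period $T$, i.e. of all sequences $\langle x_t\mid t\ge T\rangle$ in $X$ with $x_T=x$ and $x_{t+1}\in\Omega_t(x_t)$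 for all $t\ge T$. *)

theory Defs
  imports Complex_Main
begin

definition state_space :: "real \<Rightarrow> real set" where
  "state_space b = {0..b}"

definition ldo_lc_problem ::
  "real \<Rightarrow> (nat \<Rightarrow> real) \<Rightarrow> (nat \<Rightarrow> real) \<Rightarrow> (nat \<Rightarrow> real) \<Rightarrow> bool" where
  "ldo_lc_problem b p c a \<longleftrightarrow>
     (\<forall>t. c t \<ge> 0 \<and> c t + a t * b \<ge> 0) \<and>
     summable (\<lambda>t. \<bar>c t\<bar>) \<and> summable (\<lambda>t. \<bar>a t\<bar>) \<and> summable (\<lambda>t. \<bar>p t\<bar>)"

definition feasible ::
  "real \<Rightarrow> (nat \<Rightarrow> real) \<Rightarrow> (nat \<Rightarrow> real) \<Rightarrow> nat \<Rightarrow> real \<Rightarrow> real set" where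
  "feasible b c a t x = {y \<in> state_space b. y \<le> c t + a t * x}"

text \<open>A sequence indexed by the periods from \<open>T\<close> on is represented by a function on all of
  \<^typ>\<open>nat\<close> whose values at periods before \<open>T\<close> are unconstrained and irrelevant.\<close>

definition trajectories ::
  "real \<Rightarrow> (nat \<Rightarrow> real) \<Rightarrow> (nat \<Rightarrow> real) \<Rightarrow> nat \<Rightarrow> real \<Rightarrow> (nat \<Rightarrow> real) set" where
  "trajectories b c a T x =
     {s. (\<forall>t\<ge>T. s t \<in> state_space b) \<and> s T = x \<and> (\<forall>t\<ge>T. s (Suc t) \<in> feasible b c a t (s t))}"

end

theory Submission
  imports Defs
begin

text \<open>Two monotonicity facts combine. Each feasible set is closed downward among nonnegative
  reals, so a smaller next state stays feasible. As \<open>a t\<close> is nonpositive, the bound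
  \<open>c t + a t * x\<close> is antitone in \<open>x\<close>, so a smaller current state only
  enlarges the feasible set. Lowering a trajectory to nonnegative values while keeping its start
  therefore preserves every transition constraint.\<close>

theorem proposition2:
  fixes b :: real and p c a :: "nat \<Rightarrow> real"
  assumes "b > 0"
    and "ldo_lc_problem b p c a"
    and "\<forall>t. a t \<le> 0"
  shows "\<forall>T. \<forall>y \<in> state_space b. \<forall>xs ys :: nat \<Rightarrow> real.
    xs \<in> trajectories b c a T y \<longrightarrow>
    ys T = xs T \<and> xs T = y \<and> (\<forall>t>T. xs t \<ge> ys t \<and> ys t \<ge> 0) \<longrightarrow>
    ys \<in> trajectories b c a T y"
proof (intro allI ballI impI)
  fix T :: nat and y :: real and xs ys :: "nat \<Rightarrow> real"
  assume y: "y \<in> state_space b" and xs: "xs \<in> trajectories b c a T y"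
    and ys: "ys T = xs T \<and> xs T = y \<and> (\<forall>t>T. xs t \<ge> ys t \<and> ys t \<ge> 0)"
  \<comment> \<open>Domination is assumed only after \<open>T\<close>; at \<open>T\<close> both
    sequences equal \<open>y\<close>, so the two facts extend to all \<open>t \<ge> T\<close>. This
    lets the first transition, out of \<open>T\<close>, be treated like the others. The upper bound
    \<open>b\<close> on \<open>ys t\<close> is inherited from \<open>xs t\<close>.\<close>
  have le: "ys t \<le> xs t" and mem: "ys t \<in> state_space b" if "t \<ge> T" for t
  proof -
    have "xs t \<in> state_space b"
      using xs that by (simp add: trajectories_def)
    moreover have "t = T \<or> t > T"
      using that by linarith
    ultimately show "ys t \<le> xs t" and "ys t \<in> state_space b"
      using y ys by (fastforce simp: state_space_def)+
  qed
  have "ys (Suc t) \<in> feasible b c a t (ys t)" if t: "t \<ge> T" for t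
  proof -
    have "ys (Suc t) \<le> xs (Suc t)"
      using le t by simp
    also have "\<dots> \<le> c t + a t * xs t"
      using xs t by (simp add: trajectories_def feasible_def)
    \<comment> \<open>The sign of \<open>a t\<close> enters here: multiplying
      \<open>ys t \<le> xs t\<close> by it reverses the inequality.\<close>
    also have "\<dots> \<le> c t + a t * ys t"
      using mult_left_mono_neg[OF le[OF t]] assms(3) by simp
    finally show ?thesis
      using mem t by (simp add: feasible_def)
  qed
  then show "ys \<in> trajectories b c a T y"
    using mem ys by (simp add: trajectories_def)
qed

end
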